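(* Let $k$ be a field of characteristic different from $2$, let $G=\mathbb{Z}_5$ with identity $e$, and let $F:G\times G\to k^*$ be the 2-cochain defined by the $5\times5$ matrix (rows and columns indexed by the elements of $\mathbb{Z}_5$, starting with $e$) $$\begin{pmatrix}1&1&\cdots&1\\ 1&&&\\ \vdots&&H&\\ 1&&&\end{pmatrix},$$ where $H=J-2I$ is the Hadamard matrix of order $4$ with maximal excess. That is, $F(e,x)=F(x,e)=1$ for all $x$, $F(x,x)=-1$ for $x\ne e$, and $F(x,y)=1$ for $x\neq y$. Then $k_F\mathbb{Z}_5$ is a simple, commutative, nonassociative algebra.
   Context: $J$ is the $4\times4$ matrix with all entries equal to $1$ and $I$ is the $4\times 4$ identity matrix. $k_FG$ is the $k$-vector space with basis $G$ and bilinear product $x\cdot y=F(x,y)\,xy$ for $x,y\in G$, where $xy$ is the product in the group $G$. An algebra is simple if its product is nonzero and it has no two-sided ideals other than $0$ and itself. Nonassociative means not associative. *)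

theory Defs
  imports "HOL-Analysis.Analysis"
begin

text \<open>Algebras over a field are vector spaces with a bilinear product; neither associativity nor
  a unit is required.\<close>

locale nonassoc_algebra = vector_space scl
  for scl :: "'k::field \<Rightarrow> 'a::ab_group_add \<Rightarrow> 'a" +
  fixes mul :: "'a \<Rightarrow> 'a \<Rightarrow> 'a"
  assumes linear_mul_left: "Vector_Spaces.linear scl scl (\<lambda>x. mul x y)"
    and linear_mul_right: "Vector_Spaces.linear scl scl (mul x)"

definition two_sided_ideal ::
    "('k::field \<Rightarrow> 'a::ab_group_add \<Rightarrow> 'a) \<Rightarrow> ('a \<Rightarrow> 'a \<Rightarrow> 'a) \<Rightarrow> 'a set \<Rightarrow> bool"
  where "two_sided_ideal scl mul S \<longleftrightarrow>
    module.subspace scl S \<and> (\<forall>a. \<forall>x\<in>S. mul a x \<in> S \<and> mul x a \<in> S)"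

definition simple_algebra ::
    "('k::field \<Rightarrow> 'a::ab_group_add \<Rightarrow> 'a) \<Rightarrow> ('a \<Rightarrow> 'a \<Rightarrow> 'a) \<Rightarrow> bool"
  where "simple_algebra scl mul \<longleftrightarrow> nonassoc_algebra scl mul \<and>
    (\<exists>x y. mul x y \<noteq> 0) \<and> (\<forall>S. two_sided_ideal scl mul S \<longrightarrow> S = {0} \<or> S = UNIV)"

definition commutative_mul :: "('a \<Rightarrow> 'a \<Rightarrow> 'a) \<Rightarrow> bool"
  where "commutative_mul mul \<longleftrightarrow> (\<forall>x y. mul x y = mul y x)"

definition associative_mul :: "('a \<Rightarrow> 'a \<Rightarrow> 'a) \<Rightarrow> bool"
  where "associative_mul mul \<longleftrightarrow> (\<forall>x y z. mul (mul x y) z = mul x (mul y z))"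

text \<open>Groups are written additively, so the identity \<open>e\<close> is \<open>0\<close> and the product \<open>xy\<close> in \<open>G\<close>
  is \<open>x + y\<close>.\<close>

definition two_cochain :: "('g::group_add \<Rightarrow> 'g \<Rightarrow> 'k::field) \<Rightarrow> bool"
  where "two_cochain F \<longleftrightarrow>
    (\<forall>x y. F x y \<noteq> 0) \<and> (\<forall>x. F 0 x = 1 \<and> F x 0 = 1)"

text \<open>For a finite group \<open>G\<close> the space \<open>k\<^sub>FG\<close> is \<open>'k ^ 'g\<close>, with the group element \<open>g\<close> as the basis
  vector \<open>axis g 1\<close>; its product is the bilinear extension of \<open>x \<cdot> y = F(x,y) xy\<close>.\<close>

definition twisted_mul ::
    "('g::{finite,group_add} \<Rightarrow> 'g \<Rightarrow> 'k::field)
      \<Rightarrow> ('k, 'g) vec \<Rightarrow> ('k, 'g) vec \<Rightarrow> ('k, 'g) vec"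
  where "twisted_mul F a b =
    (\<Sum>x\<in>UNIV. \<Sum>y\<in>UNIV. (a $ x * b $ y * F x y) *s axis (x + y) 1)"

lemma twisted_mul_axis:
  "twisted_mul F (axis x 1) (axis y 1) = F x y *s axis (x + y) 1"
proof -
  have "twisted_mul F (axis x 1) (axis y 1) =
      (\<Sum>u\<in>UNIV. \<Sum>v\<in>UNIV. if u = x then if v = y then F x y *s axis (x + y) 1 else 0 else 0)"
    unfolding twisted_mul_def by (intro sum.cong refl) (auto simp: axis_def)
  also have "\<dots> = (\<Sum>u\<in>UNIV. if u = x then F x y *s axis (x + y) 1 else 0)"
    by (intro sum.cong refl) auto
  finally show ?thesis by simp
qed

text \<open>The matrix \<open>H = J - 2I\<close>, and the cochain on \<open>\<int>\<^sub>5\<close> given by \<open>H\<close> bordered by ones. The numeral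
  type \<open>5\<close> is the ring of integers modulo 5, of which only the additive group is used.\<close>

definition hadamard4 :: "'k::field ^ 4 ^ 4"
  where "hadamard4 = (\<chi> i j. 1) - mat 2"

definition hadamard_cochain :: "5 \<Rightarrow> 5 \<Rightarrow> 'k::field"
  where "hadamard_cochain x y =
    (if x = 0 \<or> y = 0 then 1 else if x = y then - 1 else 1)"

lemma two_cochain_hadamard_cochain: "two_cochain hadamard_cochain"
  by (simp add: two_cochain_def hadamard_cochain_def)

lemma hadamard4_orthogonal: "hadamard4 ** transpose hadamard4 = mat 4"
  by (simp add: hadamard4_def vec_eq_iff matrix_matrix_mult_def transpose_def mat_def
      sum_4 forall_4)

text \<open>The diagonal of \<open>H\<close> is constant and so is the rest, so every enumeration of the non-identity
  elements yields the same matrix.\<close>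

lemma hadamard_cochain_block:
  assumes "bij_betw \<sigma> (UNIV :: 4 set) (UNIV - {0})"
  shows "hadamard_cochain (\<sigma> i) (\<sigma> j) = hadamard4 $ i $ j"
proof -
  have "\<sigma> i \<noteq> 0" "\<sigma> j \<noteq> 0" "\<sigma> i = \<sigma> j \<longleftrightarrow> i = j"
    using assms by (auto simp: bij_betw_def inj_on_def)
  then show ?thesis
    by (simp add: hadamard_cochain_def hadamard4_def mat_def)
qed

end

theory Submission
  imports Defs
begin

text \<open>Write \<open>e\<^sub>x\<close> for the basis vector of \<open>x \<in> \<int>\<^sub>5\<close>. Commutativity is the symmetry of \<open>F\<close>, and
  associativity fails because \<open>(e\<^sub>1 e\<^sub>1) e\<^sub>4 = - e\<^sub>1\<close> while \<open>e\<^sub>1 (e\<^sub>1 e\<^sub>4) = e\<^sub>1\<close>.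

  For simplicity, the key is that multiplying by \<open>e\<^sub>-\<^sub>x\<close> and then by \<open>e\<^sub>x\<close> shifts every basis vector
  forth and back, so it is a diagonal operator, with entries \<open>\<plusminus>1\<close>
  (\<open>twisted_mul_axis_axis_nth\<close>). For \<open>x \<noteq> 0\<close> the entry is \<open>-1\<close> exactly in the positions \<open>-x\<close> and
  \<open>2x\<close>. Since \<open>2\<close> is invertible in \<open>k\<close>, every ideal is therefore closed under the coordinate projection to
  \<open>{-x, 2x}\<close> (\<open>ideal_closed_projection\<close>). For \<open>z \<noteq> 0\<close> the position \<open>z\<close> is the only common member of the
  two sets obtained from \<open>x = -z\<close> and \<open>x = 3z\<close> (as \<open>6z = z\<close>), namely \<open>{z, 3z}\<close> and \<open>{2z, z}\<close>. Hence an
  ideal contains \<open>e\<^sub>z\<close> as soon as it contains a vector whose coordinate at \<open>z\<close> is nonzero; a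
  nonzero vector without such a \<open>z\<close> is a multiple of \<open>e\<^sub>0\<close>. Finally, any one basis vector
  generates the unit \<open>e\<^sub>0\<close>, since the values of \<open>F\<close> are nonzero
  (\<open>ideal_eq_UNIV_if_axis_mem\<close>).\<close>

lemma twisted_mul_nth:
  "twisted_mul F a b $ z = (\<Sum>x\<in>UNIV. a $ x * b $ (- x + z) * F x (- x + z))"
proof -
  have "(\<Sum>y\<in>UNIV. ((a $ x * b $ y * F x y) *s axis (x + y) 1) $ z)
      = a $ x * b $ (- x + z) * F x (- x + z)" for x
  proof -
    have eq: "z = x + y \<longleftrightarrow> y = - x + z" for y
      by (metis minus_add_cancel add_minus_cancel)
    have "(\<Sum>y\<in>UNIV. ((a $ x * b $ y * F x y) *s axis (x + y) 1) $ z)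
        = (\<Sum>y\<in>UNIV. if y = - x + z then a $ x * b $ y * F x y else 0)"
      by (intro sum.cong refl) (simp add: axis_def eq)
    then show ?thesis by simp
  qed
  then show ?thesis
    by (simp add: twisted_mul_def sum_component)
qed

lemma nonassoc_algebra_twisted_mul: "nonassoc_algebra (*s) (twisted_mul F)"
proof -
  have "Vector_Spaces.linear (*s) (*s) (\<lambda>a. twisted_mul F a b)"
    and "Vector_Spaces.linear (*s) (*s) (twisted_mul F b)" for b
    by (intro Vector_Spaces.linear_iff[THEN iffD2] conjI allI vec.vector_space_axioms;
        simp add: vec_eq_iff twisted_mul_nth algebra_simps sum.distrib sum_distrib_left)+
  then show ?thesis
    by (intro nonassoc_algebra.intro nonassoc_algebra_axioms.intro vec.vector_space_axioms)
qed

lemma twisted_mul_axis_nth: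
  "twisted_mul F (axis x 1) a $ z = F x (- x + z) * a $ (- x + z)"
proof -
  have "twisted_mul F (axis x 1) a $ z
      = (\<Sum>u\<in>UNIV. if u = x then a $ (- u + z) * F u (- u + z) else 0)"
    unfolding twisted_mul_nth by (intro sum.cong refl) (simp add: axis_def)
  then show ?thesis by simp
qed

text \<open>The two shifts cancel: this composition of left multiplications is a diagonal operator.\<close>

lemma twisted_mul_axis_axis_nth:
  "twisted_mul F (axis x 1) (twisted_mul F (axis (- x) 1) a) $ z
    = F x (- x + z) * F (- x) z * a $ z"
  by (simp add: twisted_mul_axis_nth)

lemma twisted_mul_unit_right:
  assumes "two_cochain F"
  shows "twisted_mul F a (axis 0 1) = a"
proof -
  have eq: "- x + z = 0 \<longleftrightarrow> x = z" for x z :: 'a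
    by (metis add.right_neutral left_minus add_minus_cancel)
  have "twisted_mul F a (axis 0 1) $ z = (\<Sum>x\<in>UNIV. if x = z then a $ x else 0)" for z
    unfolding twisted_mul_nth
    using assms by (intro sum.cong refl) (auto simp: axis_def eq two_cochain_def)
  then show ?thesis by (simp add: vec_eq_iff)
qed

text \<open>The product of \<open>e\<^sub>-\<^sub>g\<close> and \<open>e\<^sub>g\<close> is a nonzero multiple of the unit.\<close>

lemma ideal_eq_UNIV_if_axis_mem:
  assumes ideal: "two_sided_ideal (*s) (twisted_mul F) S"
    and F: "two_cochain F" and g: "axis g 1 \<in> S"
  shows "S = UNIV"
proof -
  have sub: "vec.subspace S"
    and left: "\<And>a x. x \<in> S \<Longrightarrow> twisted_mul F a x \<in> S"
    using ideal by (auto simp: two_sided_ideal_def)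
  have "F (- g) g *s axis 0 1 \<in> S"
    using left[OF g, of "axis (- g) 1"] by (simp add: twisted_mul_axis)
  then have "inverse (F (- g) g) *s (F (- g) g *s axis 0 1) \<in> S"
    by (rule vec.subspace_scale[OF sub])
  then have "axis 0 1 \<in> S"
    using F by (simp add: two_cochain_def vector_smult_assoc)
  then show ?thesis
    using left twisted_mul_unit_right[OF F] by (metis UNIV_eq_I)
qed

lemma exhaust_5: "x = 0 \<or> x = 1 \<or> x = 2 \<or> x = 3 \<or> x = 4" for x :: 5
proof (cases x rule: bit1.cases)
  case (1 z)
  then have "z = 0 \<or> z = 1 \<or> z = 2 \<or> z = 3 \<or> z = 4" by auto
  with 1 show ?thesis by auto
qed

lemma two_neq_zero_if_CHAR:
  assumes "CHAR('k::field) \<noteq> 2"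
  shows "(2 :: 'k) \<noteq> 0"
proof
  assume "(2 :: 'k) = 0"
  then have "CHAR('k) dvd 2"
    using of_nat_eq_0_iff_char_dvd[where 'a = 'k, of 2] by simp
  then show False
    using assms CHAR_not_1' two_is_prime_nat by (metis One_nat_def prime_nat_iff)
qed

lemma commutative_hadamard:
  "commutative_mul (twisted_mul (hadamard_cochain :: 5 \<Rightarrow> 5 \<Rightarrow> 'k::field))"
  unfolding commutative_mul_def twisted_mul_def
  by (intro allI, subst sum.swap)
    (intro sum.cong refl, simp add: hadamard_cochain_def ac_simps)

lemma not_associative_hadamard:
  assumes "(2 :: 'k::field) \<noteq> 0"
  shows "\<not> associative_mul (twisted_mul (hadamard_cochain :: 5 \<Rightarrow> 5 \<Rightarrow> 'k))"
proof
  let ?m = "twisted_mul (hadamard_cochain :: 5 \<Rightarrow> 5 \<Rightarrow> 'k)"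
  assume "associative_mul ?m"
  then have "?m (?m (axis 1 1) (axis 1 1)) (axis 4 1) $ 1
      = ?m (axis 1 1) (?m (axis 1 1) (axis 4 1)) $ 1"
    by (simp add: associative_mul_def)
  moreover have "?m (?m (axis 1 1) (axis 1 1)) (axis 4 1)
      = ?m (axis 4 1) (?m (axis 1 1) (axis 1 1))"
    using commutative_hadamard unfolding commutative_mul_def by blast
  moreover have "?m (axis 4 1) (?m (axis 1 1) (axis 1 1)) $ 1 = - 1"
    unfolding twisted_mul_axis_nth by (simp add: axis_def hadamard_cochain_def)
  moreover have "?m (axis 1 1) (?m (axis 1 1) (axis 4 1)) $ 1 = 1"
    unfolding twisted_mul_axis_nth by (simp add: axis_def hadamard_cochain_def)
  ultimately have "(2 :: 'k) = 0"
    by (metis add.right_inverse one_add_one)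
  with assms show False ..
qed

text \<open>The second factor is \<open>-1\<close> only for \<open>z = -x\<close>, the first one only for \<open>z - x = x\<close>; the two signs
  never cancel, because \<open>3x \<noteq> 0\<close>.\<close>

lemma hadamard_cochain_sign:
  assumes "x \<noteq> 0"
  shows "hadamard_cochain x (- x + z) * hadamard_cochain (- x) z
    = (if z = - x \<or> z = 2 * x then - 1 else 1)"
  using assms exhaust_5[of x] exhaust_5[of z]
  by (elim disjE) (simp_all add: hadamard_cochain_def)

text \<open>Subtracting from \<open>v\<close> its image under the diagonal operator with entries \<open>\<plusminus>1\<close> leaves twice the
  part of \<open>v\<close> in the positions of the entries \<open>-1\<close>.\<close>

lemma ideal_closed_projection:
  fixes S :: "('k::field ^ 5) set"
  assumes ideal: "two_sided_ideal (*s) (twisted_mul hadamard_cochain) S"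
    and two: "(2 :: 'k) \<noteq> 0" and v: "v \<in> S" and x: "x \<noteq> 0"
  shows "(\<chi> z. if z = - x \<or> z = 2 * x then v $ z else 0) \<in> S"
proof -
  let ?w = "twisted_mul hadamard_cochain (axis x 1)
    (twisted_mul hadamard_cochain (axis (- x) 1) v)"
  have sub: "vec.subspace S" and w: "?w \<in> S"
    using ideal v by (auto simp: two_sided_ideal_def)
  have "inverse 2 *s (v - ?w) \<in> S"
    by (intro vec.subspace_scale[OF sub] vec.subspace_diff[OF sub] v w)
  also have "inverse 2 *s (v - ?w) = (\<chi> z. if z = - x \<or> z = 2 * x then v $ z else 0)"
  proof -
    have "?w $ z = (if z = - x \<or> z = 2 * x then - v $ z else v $ z)" for z
      unfolding twisted_mul_axis_axis_nth hadamard_cochain_sign[OF x] by simp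
    then show ?thesis
      using two by (auto simp: vec_eq_iff simp flip: mult_2)
  qed
  finally show ?thesis .
qed

text \<open>The projections for \<open>x = -g\<close> and \<open>x = 3g\<close> retain the positions \<open>g, 3g\<close> and \<open>2g, g\<close>, so
  applying both isolates the coordinate at \<open>g\<close>.\<close>

lemma ideal_axis_mem:
  fixes S :: "('k::field ^ 5) set"
  assumes ideal: "two_sided_ideal (*s) (twisted_mul hadamard_cochain) S"
    and two: "(2 :: 'k) \<noteq> 0" and v: "v \<in> S" and g: "g \<noteq> 0" "v $ g \<noteq> 0"
  shows "axis g 1 \<in> S"
proof -
  have sub: "vec.subspace S"
    using ideal by (simp add: two_sided_ideal_def)
  have nz: "- g \<noteq> 0" "3 * g \<noteq> 0"
    using g(1) exhaust_5[of g] by auto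
  have only: "(z = - (- g) \<or> z = 2 * (- g)) \<and> (z = - (3 * g) \<or> z = 2 * (3 * g)) \<longleftrightarrow> z = g" for z
    using g(1) exhaust_5[of g] exhaust_5[of z] by (elim disjE) simp_all
  let ?P = "\<lambda>(x :: 5) (v :: 'k ^ 5). (\<chi> z. if z = - x \<or> z = 2 * x then v $ z else 0) :: 'k ^ 5"
  have "?P (3 * g) (?P (- g) v) \<in> S"
    by (intro ideal_closed_projection[OF ideal two] v nz)
  also have "?P (3 * g) (?P (- g) v) = v $ g *s axis g 1"
    unfolding vec_eq_iff
  proof
    fix z
    have "?P (3 * g) (?P (- g) v) $ z
        = (if (z = - (- g) \<or> z = 2 * (- g)) \<and> (z = - (3 * g) \<or> z = 2 * (3 * g))
            then v $ z else 0)"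
      unfolding vec_lambda_beta by argo
    also have "\<dots> = (v $ g *s axis g 1) $ z"
      unfolding only by (simp add: axis_def)
    finally show "?P (3 * g) (?P (- g) v) $ z = (v $ g *s axis g 1) $ z" .
  qed
  finally have "inverse (v $ g) *s (v $ g *s axis g 1) \<in> S"
    by (rule vec.subspace_scale[OF sub])
  then show ?thesis
    using g(2) by (simp add: vector_smult_assoc)
qed

lemma simple_hadamard:
  assumes two: "(2 :: 'k::field) \<noteq> 0"
  shows "simple_algebra (*s) (twisted_mul (hadamard_cochain :: 5 \<Rightarrow> 5 \<Rightarrow> 'k))"
  unfolding simple_algebra_def
proof (intro conjI allI impI)
  let ?m = "twisted_mul (hadamard_cochain :: 5 \<Rightarrow> 5 \<Rightarrow> 'k)"
  show "nonassoc_algebra (*s) ?m"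
    by (rule nonassoc_algebra_twisted_mul)
  have "?m (axis 0 1) (axis 0 1) \<noteq> 0"
    by (simp add: twisted_mul_unit_right two_cochain_hadamard_cochain axis_eq_0_iff)
  then show "\<exists>x y. ?m x y \<noteq> 0" by blast
  fix S assume ideal: "two_sided_ideal (*s) ?m S"
  then have sub: "vec.subspace S"
    by (simp add: two_sided_ideal_def)
  show "S = {0} \<or> S = UNIV"
  proof (cases "S = {0}")
    case False
    then obtain v where v: "v \<in> S" "v \<noteq> 0"
      using vec.subspace_0[OF sub] by blast
    have "\<exists>g. axis g 1 \<in> S"
    proof (cases "\<exists>g. g \<noteq> 0 \<and> v $ g \<noteq> 0")
      case True
      then show ?thesis
        using ideal_axis_mem[OF ideal two v(1)] by blast
    next
      case False
      then have v_eq: "v = v $ 0 *s axis 0 1"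
        by (auto simp: vec_eq_iff axis_def)
      then have "v $ 0 \<noteq> 0"
        using v(2) by (metis vector_smult_lzero)
      moreover have "inverse (v $ 0) *s (v $ 0 *s axis 0 1) \<in> S"
        using vec.subspace_scale[OF sub v(1)] v_eq by metis
      ultimately have "axis 0 1 \<in> S"
        by (simp add: vector_smult_assoc)
      then show ?thesis ..
    qed
    then show ?thesis
      using ideal_eq_UNIV_if_axis_mem[OF ideal two_cochain_hadamard_cochain] by blast
  qed simp
qed

theorem proposition5p4:
  fixes F :: "5 \<Rightarrow> 5 \<Rightarrow> 'k::field"
  assumes "CHAR('k) \<noteq> 2"
    and "F = hadamard_cochain"
  shows "simple_algebra ((*s) :: 'k \<Rightarrow> 'k ^ 5 \<Rightarrow> 'k ^ 5) (twisted_mul F)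
    \<and> commutative_mul (twisted_mul F)
    \<and> \<not> associative_mul (twisted_mul F)"
  using two_neq_zero_if_CHAR[OF assms(1)] assms(2)
  by (simp add: simple_hadamard commutative_hadamard not_associative_hadamard)

end
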